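(* $\pi^*(w)=\pi_0(w)$ for $0<w<c/r$, and $\pi^*(w)>\pi_0(w)$ for $-L<w<0$.
   Context: Parameters: $r>0$, $\mu>r$, $\sigma>0$, $c>0$, $\lambda>0$, $\rho>0$, $L>0$, and $\delta=\frac12\left(\frac{\mu-r}\sigma\right)^2$. An individual with wealth $dW^\pi_t=(rW^\pi_t+(\mu-r)\pi_t-c)\,dt+\sigma\pi_t\,dB_t$ ($B$ a standard Brownian motion), and with an independent exponential time of death of rate $\lambda$, chooses the amount $\pi_t$ invested in the risky asset. $\pi_0$ denotes the optimal (feedback) investment strategy when minimizing the probability of lifetime ruin (that wealth reaches a given ruin level before death). By a known result it is independent of the ruin level and equals $$\pi_0(w)=\frac{\mu-r}{\sigma^2}\,\frac{c/r-w}{q-1},\quad w<c/r,\qquad q=\frac1{2r}\left[(r+\lambda+\delta)+\sqrt{(r+\lambda+\delta)^2-4r\lambda}\right]>1.$$ $\pi^*$ denotes the optimal feedback strategy when minimizing the probability of lifetime exponential Parisian ruin, i.e. that, before death, an excursion of wealth below $0$ lasts longer than an independent exponential clock of rate $\rho$ (reset at each excursion), where the game is stopped with payoff $\rho/(\lambda+\rho)$ if wealth reaches $-L$ first. Explicitly, with $B_3>1$ and $B_4<0$ given by $$\frac1{2\delta}\left[(r-\lambda-\rho+\delta)\pm\sqrt{(r-\lambda-\rho+\delta)^2+4\delta(\lambda+\rho)}\right]$$ (sign $+$ for $B_3$, $-$ for $B_4$), $$\pi^*(w)=\begin{cases}\dfrac{\mu-r}{\sigma^2}\left(\dfrac cr+L\right)\dfrac{(B_3-1)(1-B_4)}{B_3-B_4}\left[B_3z^{B_3-1}-B_4z^{B_4-1}\right],&-L<w<0,\\[2ex]\dfrac{\mu-r}{\sigma^2}\,\dfrac{c/r-w}{q-1},&0<w\le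 c/r,\end{cases}$$ where, for $-L<w<0$, $z=z(w)$ is the unique solution in $]y_{0L},1[$ of $$\frac cr-w=\left(\frac cr+L\right)\left[\frac{B_3(1-B_4)}{B_3-B_4}z^{B_3-1}+\frac{B_4(B_3-1)}{B_3-B_4}z^{B_4-1}\right],$$ and $y_{0L}\in\,]0,1[$ is the unique solution in $]0,1[$ of the same equation with $w=0$. *)

theory Defs
  imports Complex_Main
begin

definition delta :: "real \<Rightarrow> real \<Rightarrow> real \<Rightarrow> real" where
  "delta r \<mu> \<sigma> = 1 / 2 * ((\<mu> - r) / \<sigma>)\<^sup>2"

text \<open>The hazard rate of the time of death is written \<open>lam\<close>, and \<open>\<rho>\<close> is the rate of
  the Parisian excursion clock. The optimal feedback strategies are given by their closed forms;
  outside the range of wealth on which the closed form is available they are \<open>undefined\<close>.\<close>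

definition ruin_q :: "real \<Rightarrow> real \<Rightarrow> real \<Rightarrow> real \<Rightarrow> real" where
  "ruin_q r \<mu> \<sigma> lam =
     (let \<delta> = delta r \<mu> \<sigma> in
      1 / (2 * r) * ((r + lam + \<delta>) + sqrt ((r + lam + \<delta>)\<^sup>2 - 4 * r * lam)))"

definition pi_zero :: "real \<Rightarrow> real \<Rightarrow> real \<Rightarrow> real \<Rightarrow> real \<Rightarrow> real \<Rightarrow> real" where
  "pi_zero r \<mu> \<sigma> c lam w =
     (if w < c / r
      then (\<mu> - r) / \<sigma>\<^sup>2 * ((c / r - w) / (ruin_q r \<mu> \<sigma> lam - 1))
      else undefined)"

definition B3 :: "real \<Rightarrow> real \<Rightarrow> real \<Rightarrow> real \<Rightarrow> real \<Rightarrow> real" where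
  "B3 r \<mu> \<sigma> lam \<rho> =
     (let \<delta> = delta r \<mu> \<sigma> in
      1 / (2 * \<delta>) * ((r - lam - \<rho> + \<delta>)
        + sqrt ((r - lam - \<rho> + \<delta>)\<^sup>2 + 4 * \<delta> * (lam + \<rho>))))"

definition B4 :: "real \<Rightarrow> real \<Rightarrow> real \<Rightarrow> real \<Rightarrow> real \<Rightarrow> real" where
  "B4 r \<mu> \<sigma> lam \<rho> =
     (let \<delta> = delta r \<mu> \<sigma> in
      1 / (2 * \<delta>) * ((r - lam - \<rho> + \<delta>)
        - sqrt ((r - lam - \<rho> + \<delta>)\<^sup>2 + 4 * \<delta> * (lam + \<rho>))))"

text \<open>The equation in \<open>z\<close> linking wealth \<open>w\<close> to the dual variable. It is only used for \<open>z > 0\<close>,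
  where \<open>powr\<close> is the usual real power.\<close>

definition dual_eq ::
  "real \<Rightarrow> real \<Rightarrow> real \<Rightarrow> real \<Rightarrow> real \<Rightarrow> real \<Rightarrow> real \<Rightarrow> real \<Rightarrow> real \<Rightarrow> bool" where
  "dual_eq r \<mu> \<sigma> c lam \<rho> L w z \<longleftrightarrow>
     (let b3 = B3 r \<mu> \<sigma> lam \<rho>; b4 = B4 r \<mu> \<sigma> lam \<rho> in
      c / r - w = (c / r + L) *
        (b3 * (1 - b4) / (b3 - b4) * z powr (b3 - 1)
         + b4 * (b3 - 1) / (b3 - b4) * z powr (b4 - 1)))"

definition y0L :: "real \<Rightarrow> real \<Rightarrow> real \<Rightarrow> real \<Rightarrow> real \<Rightarrow> real \<Rightarrow> real \<Rightarrow> real" where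
  "y0L r \<mu> \<sigma> c lam \<rho> L =
     (THE y. y \<in> {0<..<1} \<and> dual_eq r \<mu> \<sigma> c lam \<rho> L 0 y)"

definition dual_z ::
  "real \<Rightarrow> real \<Rightarrow> real \<Rightarrow> real \<Rightarrow> real \<Rightarrow> real \<Rightarrow> real \<Rightarrow> real \<Rightarrow> real" where
  "dual_z r \<mu> \<sigma> c lam \<rho> L w =
     (THE z. z \<in> {y0L r \<mu> \<sigma> c lam \<rho> L<..<1} \<and> dual_eq r \<mu> \<sigma> c lam \<rho> L w z)"

definition pi_star ::
  "real \<Rightarrow> real \<Rightarrow> real \<Rightarrow> real \<Rightarrow> real \<Rightarrow> real \<Rightarrow> real \<Rightarrow> real \<Rightarrow> real" where
  "pi_star r \<mu> \<sigma> c lam \<rho> L w =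
     (if - L < w \<and> w < 0 then
        (let b3 = B3 r \<mu> \<sigma> lam \<rho>; b4 = B4 r \<mu> \<sigma> lam \<rho>;
             z = dual_z r \<mu> \<sigma> c lam \<rho> L w in
         (\<mu> - r) / \<sigma>\<^sup>2 * (c / r + L) * ((b3 - 1) * (1 - b4) / (b3 - b4))
           * (b3 * z powr (b3 - 1) - b4 * z powr (b4 - 1)))
      else if 0 < w \<and> w \<le> c / r then
        (\<mu> - r) / \<sigma>\<^sup>2 * ((c / r - w) / (ruin_q r \<mu> \<sigma> lam - 1))
      else undefined)"

end

theory Submission
  imports Defs
begin

text \<open>For positive wealth both strategies are given by the same formula; all the content lies
  below zero.

  Write \<open>a > 1\<close> and \<open>b < 0\<close> for the two roots \<open>B3\<close> and \<open>B4\<close>. Below zero wealth, the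
  distance \<open>c / r - w\<close> to the safe level is \<open>c / r + L\<close> times

    \<open>h z = (a (1 - b) z powr (a - 1) + b (a - 1) z powr (b - 1)) / (a - b)\<close>,

  an increasing function on the positive axis that vanishes at some point of \<open>]0,1[\<close> and is
  \<open>1\<close> at \<open>z = 1\<close>. Hence each value strictly between \<open>0\<close> and \<open>1\<close> is taken exactly once in
  \<open>]0,1[\<close>, so the dual variable \<open>z\<close> is well defined; moreover \<open>z < 1\<close>.

  After cancelling \<open>(\<mu> - r) / \<sigma>\<^sup>2\<close> and \<open>c / r + L\<close>, the inequality to prove for negative wealth
  is

    \<open>(q - 1) (a - 1) (1 - b) (a z powr (a - 1) - b z powr (b - 1)) / (a - b) > h z\<close>.

  Two facts combine. By Vieta's formulas \<open>(a - 1) (1 - b) = r / \<delta>\<close>, independently of \<open>\<rho>\<close>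
  (\<open>B3_B4_product\<close>), and \<open>q - 1 > \<delta> / r\<close> (\<open>ruin_q_lower_bound\<close>); so the constant
  \<open>(q - 1) (a - 1) (1 - b)\<close> exceeds \<open>1\<close>. And

    \<open>(a z powr (a - 1) - b z powr (b - 1)) / (a - b) - h z
       = a b (z powr (a - 1) - z powr (b - 1)) / (a - b)\<close>

  is nonnegative for \<open>0 < z \<le> 1\<close>, because \<open>a b < 0\<close> and
  \<open>z powr (a - 1) \<le> 1 \<le> z powr (b - 1)\<close> (\<open>relative_shortfall_less\<close>).\<close>

section \<open>The roots of the quadratic equations\<close>

lemma delta_pos:
  assumes "\<mu> > r" and "\<sigma> > 0"
  shows "delta r \<mu> \<sigma> > 0"
  using assms by (simp add: delta_def)

lemma B3_gt_1_B4_neg: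
  assumes "r > 0" and "\<mu> > r" and "\<sigma> > 0" and "lam > 0" and "\<rho> > 0"
  shows "B3 r \<mu> \<sigma> lam \<rho> > 1" and "B4 r \<mu> \<sigma> lam \<rho> < 0"
proof -
  define d where "d = delta r \<mu> \<sigma>"
  define P where "P = r - lam - \<rho> + d"
  define S where "S = sqrt (P\<^sup>2 + 4 * d * (lam + \<rho>))"
  have d: "d > 0" using delta_pos assms by (simp add: d_def)
  have "P\<^sup>2 + 4 * d * (lam + \<rho>) - (2 * d - P)\<^sup>2 = 4 * d * r"
    by (simp add: P_def power2_eq_square algebra_simps)
  moreover have "4 * d * r > 0" using d assms by simp
  ultimately have "S > 2 * d - P"
    unfolding S_def by (intro real_less_rsqrt) linarith
  then show "B3 r \<mu> \<sigma> lam \<rho> > 1"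
    using d by (simp add: B3_def Let_def flip: d_def P_def S_def)
  have "4 * d * (lam + \<rho>) > 0" using d assms by simp
  then have "S > P"
    unfolding S_def by (intro real_less_rsqrt) linarith
  then show "B4 r \<mu> \<sigma> lam \<rho> < 0"
    using d by (simp add: B4_def Let_def divide_neg_pos flip: d_def P_def S_def)
qed

text \<open>\<open>B3\<close> and \<open>B4\<close> are the roots of \<open>\<delta> x\<^sup>2 - (r - lam - \<rho> + \<delta>) x - (lam + \<rho>)\<close>, whose value
  at \<open>x = 1\<close> is \<open>- r\<close>.\<close>

lemma B3_B4_product:
  assumes "r > 0" and "\<mu> > r" and "\<sigma> > 0" and "lam > 0" and "\<rho> > 0"
  shows "(B3 r \<mu> \<sigma> lam \<rho> - 1) * (1 - B4 r \<mu> \<sigma> lam \<rho>) = r / delta r \<mu> \<sigma>"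
proof -
  define d where "d = delta r \<mu> \<sigma>"
  define P where "P = r - lam - \<rho> + d"
  define S where "S = sqrt (P\<^sup>2 + 4 * d * (lam + \<rho>))"
  have d: "d > 0" using delta_pos assms by (simp add: d_def)
  have S2: "S\<^sup>2 = P\<^sup>2 + 4 * d * (lam + \<rho>)"
    using d assms by (simp add: S_def)
  have "B3 r \<mu> \<sigma> lam \<rho> = (P + S) / (2 * d)"
    by (simp add: B3_def Let_def flip: d_def P_def S_def)
  then have "B3 r \<mu> \<sigma> lam \<rho> - 1 = (S - (2 * d - P)) / (2 * d)"
    using d by (simp add: field_simps)
  moreover have "B4 r \<mu> \<sigma> lam \<rho> = (P - S) / (2 * d)"
    by (simp add: B4_def Let_def flip: d_def P_def S_def)
  then have "1 - B4 r \<mu> \<sigma> lam \<rho> = (S + (2 * d - P)) / (2 * d)"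
    using d by (simp add: field_simps)
  ultimately have "(B3 r \<mu> \<sigma> lam \<rho> - 1) * (1 - B4 r \<mu> \<sigma> lam \<rho>)
      = ((S - (2 * d - P)) * (S + (2 * d - P))) / (2 * d * (2 * d))"
    by (simp only: times_divide_times_eq)
  also have "\<dots> = (S\<^sup>2 - (2 * d - P)\<^sup>2) / (4 * d\<^sup>2)"
    by (simp add: power2_eq_square algebra_simps)
  also have "S\<^sup>2 - (2 * d - P)\<^sup>2 = 4 * d * r"
    unfolding S2 by (simp add: P_def power2_eq_square algebra_simps)
  finally show ?thesis
    using d by (simp add: d_def power2_eq_square)
qed

text \<open>\<open>ruin_q\<close> is the larger root of \<open>r x\<^sup>2 - (r + lam + \<delta>) x + lam\<close>, which takes the negative
  value \<open>- lam \<delta> / r\<close> at \<open>x = 1 + \<delta> / r\<close>.\<close>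

lemma ruin_q_lower_bound:
  assumes "r > 0" and "\<mu> > r" and "\<sigma> > 0" and "lam > 0"
  shows "ruin_q r \<mu> \<sigma> lam - 1 > delta r \<mu> \<sigma> / r"
proof -
  define d where "d = delta r \<mu> \<sigma>"
  define S where "S = sqrt ((r + lam + d)\<^sup>2 - 4 * r * lam)"
  have d: "d > 0" using delta_pos assms by (simp add: d_def)
  have "(r + lam + d)\<^sup>2 - 4 * r * lam - (r + d - lam)\<^sup>2 = 4 * d * lam"
    by (simp add: power2_eq_square algebra_simps)
  moreover have "4 * d * lam > 0" using d assms by simp
  ultimately have "S > r + d - lam"
    unfolding S_def by (intro real_less_rsqrt) linarith
  moreover have "ruin_q r \<mu> \<sigma> lam = (r + lam + d + S) / (2 * r)"
    by (simp add: ruin_q_def Let_def flip: d_def S_def)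
  ultimately show ?thesis
    using assms by (simp add: field_simps flip: d_def)
qed

section \<open>The dual variable\<close>

text \<open>At \<open>a = B3\<close> and \<open>b = B4\<close> this is the distance from wealth to the safe level \<open>c / r\<close>,
  relative to the distance \<open>c / r + L\<close> from the lowest level, as a function of the dual
  variable.\<close>

definition relative_shortfall :: "real \<Rightarrow> real \<Rightarrow> real \<Rightarrow> real" where
  "relative_shortfall a b z =
     a * (1 - b) / (a - b) * z powr (a - 1) + b * (a - 1) / (a - b) * z powr (b - 1)"

lemma relative_shortfall_1:
  assumes "a > 1" and "b < 0"
  shows "relative_shortfall a b 1 = 1"
proof -
  have "a * (1 - b) / (a - b) + b * (a - 1) / (a - b) = (a - b) / (a - b)"
    by (simp add: algebra_simps flip: add_divide_distrib diff_divide_distrib)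
  then show ?thesis
    using assms by (simp add: relative_shortfall_def)
qed

text \<open>The second coefficient is negative, but so is the exponent \<open>b - 1\<close>: both terms increase.\<close>

lemma relative_shortfall_strict_mono:
  assumes a: "a > 1" and b: "b < 0"
  shows "strict_mono_on {0<..} (relative_shortfall a b)"
proof (rule strict_mono_onI)
  fix x y :: real
  assume "x \<in> {0<..}" and "y \<in> {0<..}" and "x < y"
  then have "0 < x" and "x < y" by auto
  have "x powr (a - 1) < y powr (a - 1)"
    using \<open>0 < x\<close> \<open>x < y\<close> a by (simp add: powr_less_mono2)
  moreover have "a * (1 - b) / (a - b) > 0" using a b by simp
  moreover have "y powr (b - 1) < x powr (b - 1)"
    using \<open>0 < x\<close> \<open>x < y\<close> b by (simp add: powr_less_mono2_neg)
  moreover have "b * (a - 1) / (a - b) < 0"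
    using a b by (simp add: divide_neg_pos mult_neg_pos)
  ultimately show "relative_shortfall a b x < relative_shortfall a b y"
    unfolding relative_shortfall_def
    by (intro add_strict_mono mult_strict_left_mono mult_strict_left_mono_neg)
qed

text \<open>Instead of the limit \<open>-\<infinity>\<close> at \<open>0\<close>, an explicit zero serves as the left end point for the
  intermediate value theorem.\<close>

lemma relative_shortfall_zero:
  assumes a: "a > 1" and b: "b < 0"
  obtains z where "0 < z" and "z < 1" and "relative_shortfall a b z = 0"
proof
  define k where "k = - b * (a - 1) / (a * (1 - b))"
  define z where "z = k powr (1 / (a - b))"
  have den: "a * (1 - b) > 0" using a b by simp
  have "- b * (a - 1) > 0" using a b by (simp add: mult_neg_pos)
  then have k: "0 < k" unfolding k_def using den by (rule divide_pos_pos)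
  have "- b * (a - 1) < a * (1 - b)" using a b by (simp add: algebra_simps)
  then have "k < 1" unfolding k_def using den by (simp only: divide_less_eq_1_pos)
  show "0 < z" using k by (simp add: z_def)
  show "z < 1"
    using powr_less_mono2[of "1 / (a - b)" k 1] k \<open>k < 1\<close> a b by (simp add: z_def)
  have "z powr (a - b) = k"
    using k a b by (simp add: z_def powr_powr)
  then have "z powr (a - 1) = k * z powr (b - 1)"
    using powr_add[of z "a - b" "b - 1"] by simp
  moreover have "a * (1 - b) * k = - b * (a - 1)"
    unfolding k_def using a b by simp
  ultimately have "a * (1 - b) * z powr (a - 1) = - b * (a - 1) * z powr (b - 1)"
    by (metis mult.assoc)
  then have "(a * (1 - b) * z powr (a - 1) + b * (a - 1) * z powr (b - 1)) / (a - b) = 0"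
    by simp
  then show "relative_shortfall a b z = 0"
    by (simp add: relative_shortfall_def add_divide_distrib)
qed

lemma relative_shortfall_solution:
  assumes a: "a > 1" and b: "b < 0" and v: "0 < v" "v < 1"
  obtains z where "0 < z" and "z < 1" and "relative_shortfall a b z = v"
proof -
  obtain x where x: "0 < x" "x < 1" "relative_shortfall a b x = 0"
    using relative_shortfall_zero[OF a b] .
  have "continuous_on {x..1} (relative_shortfall a b)"
    unfolding relative_shortfall_def using x(1) by (intro continuous_intros) auto
  then obtain z where z: "x \<le> z" "z \<le> 1" "relative_shortfall a b z = v"
    using IVT'[of "relative_shortfall a b" x v 1] x v relative_shortfall_1[OF a b] by auto
  moreover have "z \<noteq> 1" using z v relative_shortfall_1[OF a b] by auto
  ultimately show thesis using that[of z] x(1) by auto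
qed

lemma dual_eq_iff_relative_shortfall:
  assumes "r > 0" and "c > 0" and "L > 0"
  shows "dual_eq r \<mu> \<sigma> c lam \<rho> L w z \<longleftrightarrow>
    relative_shortfall (B3 r \<mu> \<sigma> lam \<rho>) (B4 r \<mu> \<sigma> lam \<rho>) z = (c / r - w) / (c / r + L)"
proof -
  have "c / r + L > 0" using assms by (simp add: add_pos_pos)
  then show ?thesis
    unfolding dual_eq_def Let_def relative_shortfall_def[symmetric]
    by (auto simp: eq_divide_eq mult.commute[of "c / r + L"])
qed

text \<open>Both definite descriptions denote: \<open>y0L\<close> by existence and uniqueness on \<open>]0,1[\<close>; and for
  \<open>w < 0\<close> the solution exceeds \<open>y0L\<close> by monotonicity, since \<open>c / r - w\<close> exceeds \<open>c / r\<close>.\<close>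

lemma y0L_solution:
  assumes "r > 0" and "\<mu> > r" and "\<sigma> > 0" and "c > 0" and "lam > 0" and "\<rho> > 0" and "L > 0"
  shows "y0L r \<mu> \<sigma> c lam \<rho> L \<in> {0<..<1}"
    and "dual_eq r \<mu> \<sigma> c lam \<rho> L 0 (y0L r \<mu> \<sigma> c lam \<rho> L)"
proof -
  note roots = B3_gt_1_B4_neg[OF assms(1-3,5,6)]
  have cr: "0 < c / r" using assms by simp
  have "0 < (c / r - 0) / (c / r + L)"
    using cr \<open>L > 0\<close> by (intro divide_pos_pos) linarith+
  moreover have "(c / r - 0) / (c / r + L) < 1"
    using cr \<open>L > 0\<close> by (subst divide_less_eq_1_pos) linarith+
  ultimately obtain y where y: "0 < y" "y < 1"
    "relative_shortfall (B3 r \<mu> \<sigma> lam \<rho>) (B4 r \<mu> \<sigma> lam \<rho>) y = (c / r - 0) / (c / r + L)"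
    by (rule relative_shortfall_solution[OF roots])
  have "\<exists>!y. y \<in> {0<..<1} \<and> dual_eq r \<mu> \<sigma> c lam \<rho> L 0 y"
    unfolding dual_eq_iff_relative_shortfall[OF assms(1,4,7)]
    using y strict_mono_on_eqD[OF relative_shortfall_strict_mono[OF roots]]
    by (intro ex1I[of _ y]) auto
  from theI'[OF this] show "y0L r \<mu> \<sigma> c lam \<rho> L \<in> {0<..<1}"
    and "dual_eq r \<mu> \<sigma> c lam \<rho> L 0 (y0L r \<mu> \<sigma> c lam \<rho> L)"
    by (auto simp: y0L_def)
qed

lemma dual_z_solution:
  assumes "r > 0" and "\<mu> > r" and "\<sigma> > 0" and "c > 0" and "lam > 0" and "\<rho> > 0" and "L > 0"
    and w: "- L < w" "w < 0"
  shows "dual_z r \<mu> \<sigma> c lam \<rho> L w \<in> {0<..<1}"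
    and "dual_eq r \<mu> \<sigma> c lam \<rho> L w (dual_z r \<mu> \<sigma> c lam \<rho> L w)"
proof -
  note roots = B3_gt_1_B4_neg[OF assms(1-3,5,6)]
  note mono = relative_shortfall_strict_mono[OF roots]
  note eq = dual_eq_iff_relative_shortfall[OF assms(1,4,7)]
  note y0 = y0L_solution[OF assms(1-7), unfolded eq]
  have cr: "0 < c / r" using assms by simp
  have "0 < (c / r - w) / (c / r + L)"
    using cr w by (intro divide_pos_pos) linarith+
  moreover have "(c / r - w) / (c / r + L) < 1"
    using cr w by (subst divide_less_eq_1_pos) linarith+
  ultimately obtain z where z: "0 < z" "z < 1"
    "relative_shortfall (B3 r \<mu> \<sigma> lam \<rho>) (B4 r \<mu> \<sigma> lam \<rho>) z = (c / r - w) / (c / r + L)"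
    by (rule relative_shortfall_solution[OF roots])
  have "(c / r - 0) / (c / r + L) < (c / r - w) / (c / r + L)"
    using cr w by (intro divide_strict_right_mono) auto
  then have "y0L r \<mu> \<sigma> c lam \<rho> L < z"
    using strict_mono_on_less[OF mono, of "y0L r \<mu> \<sigma> c lam \<rho> L" z] y0 z by auto
  then have "\<exists>!z. z \<in> {y0L r \<mu> \<sigma> c lam \<rho> L<..<1} \<and> dual_eq r \<mu> \<sigma> c lam \<rho> L w z"
    unfolding eq using y0(1) z strict_mono_on_eqD[OF mono]
    by (intro ex1I[of _ z]) auto
  from theI'[OF this] show "dual_z r \<mu> \<sigma> c lam \<rho> L w \<in> {0<..<1}"
    and "dual_eq r \<mu> \<sigma> c lam \<rho> L w (dual_z r \<mu> \<sigma> c lam \<rho> L w)"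
    using y0(1) by (auto simp: dual_z_def)
qed

section \<open>Comparison of the strategies\<close>

text \<open>The factor \<open>1\<close> in place of \<open>m\<close> already gives the weak inequality, with equality
  at \<open>z = 1\<close>: after multiplication by \<open>a - b\<close> the two sides differ by
  \<open>a b (z powr (a - 1) - z powr (b - 1))\<close>. The factor \<open>m\<close> then makes the inequality strict,
  since the expression that it multiplies is positive.\<close>

lemma relative_shortfall_less:
  assumes a: "a > 1" and b: "b < 0" and z: "0 < z" "z \<le> 1" and m: "m > 1"
  shows "relative_shortfall a b z < m * ((a * z powr (a - 1) - b * z powr (b - 1)) / (a - b))"
proof -
  define s where "s = z powr (a - 1)"
  define t where "t = z powr (b - 1)"
  have "s \<le> t" using z a b by (simp add: s_def t_def powr_mono')
  then have "0 \<le> (a * b) * (s - t)"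
    using a b by (simp add: zero_le_mult_iff mult_le_0_iff)
  then have "a * (1 - b) * s + b * (a - 1) * t \<le> a * s - b * t"
    by (simp add: algebra_simps)
  then have "relative_shortfall a b z \<le> (a * s - b * t) / (a - b)"
    using a b by (simp add: relative_shortfall_def divide_right_mono
        flip: s_def t_def add_divide_distrib)
  also have "\<dots> < m * ((a * s - b * t) / (a - b))"
  proof -
    have "0 < s" and "0 < t" using z by (auto simp: s_def t_def)
    then have "0 < a * s" and "b * t < 0" using a b by (auto simp: mult_neg_pos)
    then have "0 < (a * s - b * t) / (a - b)" using a b by (intro divide_pos_pos) auto
    then show ?thesis using m by (simp only: mult_less_cancel_right1) simp
  qed
  finally show ?thesis by (simp add: s_def t_def)
qed

lemma pi_star_gt_pi_zero:
  assumes "r > 0" and "\<mu> > r" and "\<sigma> > 0" and "c > 0" and "lam > 0" and "\<rho> > 0" and "L > 0"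
    and w: "- L < w" "w < 0"
  shows "pi_star r \<mu> \<sigma> c lam \<rho> L w > pi_zero r \<mu> \<sigma> c lam w"
proof -
  define a where "a = B3 r \<mu> \<sigma> lam \<rho>"
  define b where "b = B4 r \<mu> \<sigma> lam \<rho>"
  define p where "p = ruin_q r \<mu> \<sigma> lam - 1"
  define z where "z = dual_z r \<mu> \<sigma> c lam \<rho> L w"
  define K where "K = c / r + L"
  define M where "M = (\<mu> - r) / \<sigma>\<^sup>2"
  define N where "N = (a * z powr (a - 1) - b * z powr (b - 1)) / (a - b)"
  have a: "a > 1" and b: "b < 0"
    using B3_gt_1_B4_neg[OF assms(1-3,5,6)] by (simp_all add: a_def b_def)
  have z: "0 < z" "z < 1"
    using dual_z_solution(1)[OF assms] by (simp_all add: z_def)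
  have cr: "c / r > 0" using assms by simp
  have K: "K > 0" unfolding K_def using cr assms by linarith
  have M: "M > 0" using assms by (simp add: M_def)
  have d: "delta r \<mu> \<sigma> / r > 0" using delta_pos assms by simp
  have pd: "p > delta r \<mu> \<sigma> / r"
    using ruin_q_lower_bound assms by (simp add: p_def)
  then have p: "p > 0" using d by simp
  have prod: "(a - 1) * (1 - b) = r / delta r \<mu> \<sigma>"
    using B3_B4_product[OF assms(1-3,5,6)] by (simp add: a_def b_def)
  have "p * ((a - 1) * (1 - b)) > 1"
    unfolding prod using pd delta_pos[OF assms(2,3)] assms(1) by (simp add: field_simps)
  then have "relative_shortfall a b z < p * ((a - 1) * (1 - b)) * N"
    unfolding N_def using relative_shortfall_less[OF a b] z by simp
  then have "relative_shortfall a b z / p < (a - 1) * (1 - b) * N"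
    using p by (simp add: divide_less_eq mult.commute mult.left_commute)
  then have less: "M * K * (relative_shortfall a b z / p) < M * K * ((a - 1) * (1 - b) * N)"
    using M K by (intro mult_strict_left_mono mult_pos_pos)
  have "relative_shortfall a b z = (c / r - w) / K"
    using dual_z_solution(2)[OF assms]
    by (simp add: dual_eq_iff_relative_shortfall[OF assms(1,4,7)] a_def b_def z_def K_def)
  then have "pi_zero r \<mu> \<sigma> c lam w = M * K * (relative_shortfall a b z / p)"
    using w cr K by (simp add: pi_zero_def M_def p_def)
  moreover have "pi_star r \<mu> \<sigma> c lam \<rho> L w = M * K * ((a - 1) * (1 - b) * N)"
    using w unfolding pi_star_def Let_def
    by (simp add: N_def M_def K_def flip: a_def b_def z_def)
  ultimately show ?thesis using less by simp
qed

theorem proposition3p1: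
  fixes r \<mu> \<sigma> c lam \<rho> L :: real
  assumes "r > 0" and "\<mu> > r" and "\<sigma> > 0" and "c > 0" and "lam > 0" and "\<rho> > 0" and "L > 0"
  shows "(\<forall>w. 0 < w \<and> w < c / r \<longrightarrow>
            pi_star r \<mu> \<sigma> c lam \<rho> L w = pi_zero r \<mu> \<sigma> c lam w)
       \<and> (\<forall>w. - L < w \<and> w < 0 \<longrightarrow>
            pi_star r \<mu> \<sigma> c lam \<rho> L w > pi_zero r \<mu> \<sigma> c lam w)"
  using pi_star_gt_pi_zero[OF assms] by (auto simp: pi_star_def pi_zero_def)

end
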